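(* Let $k$ be an algebraically closed field of characteristic zero. Any $n$-dimensional Lie algebra $L$ over $k$ with $i(L)\ge n-2$ satisfies Rentschler's property.
   Context: For $\xi\in L^*$ put $L(\xi)=\{x\in L : \xi([x,y])=0 \text{ for all } y\in L\}$; the index is $i(L)=\min_{\xi\in L^*}\dim L(\xi)$; the magic number is $c(L)=(\dim L+i(L))/2$ (an integer). $\alpha(L)$ denotes the maximum dimension of an abelian subalgebra of $L$. $L$ satisfies Rentschler's property if $\alpha(L)\ge c(L)-1$. *)

theory Defs
  imports Complex_Main "HOL-Computational_Algebra.Computational_Algebra"
begin

(* The Lie algebra is the whole type 'v; the zero algebra is included. *)
locale lie_algebra = vector_space scale
  for scale :: "'k::field \<Rightarrow> 'v::ab_group_add \<Rightarrow> 'v" +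
  fixes bracket :: "'v \<Rightarrow> 'v \<Rightarrow> 'v"
  assumes bracket_linear_left: "Vector_Spaces.linear scale scale (\<lambda>x. bracket x y)"
    and bracket_linear_right: "Vector_Spaces.linear scale scale (\<lambda>y. bracket x y)"
    and bracket_self: "bracket x x = 0"
    and jacobi: "bracket x (bracket y z) + bracket y (bracket z x) + bracket z (bracket x y) = 0"
begin

definition lie_subalgebra :: "'v set \<Rightarrow> bool" where
  "lie_subalgebra A \<longleftrightarrow> subspace A \<and> (\<forall>x\<in>A. \<forall>y\<in>A. bracket x y \<in> A)"

definition abelian_subalgebra :: "'v set \<Rightarrow> bool" where
  "abelian_subalgebra A \<longleftrightarrow> lie_subalgebra A \<and> (\<forall>x\<in>A. \<forall>y\<in>A. bracket x y = 0)"

definition dual_space :: "('v \<Rightarrow> 'k) set" where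
  "dual_space = {\<xi>. Vector_Spaces.linear scale (*) \<xi>}"

definition stabilizer :: "('v \<Rightarrow> 'k) \<Rightarrow> 'v set" where
  "stabilizer \<xi> = {x. \<forall>y. \<xi> (bracket x y) = 0}"

(* Min and Max below are taken over finite nonempty sets, hence are genuine extrema,
   only when the algebra is finite-dimensional: see the two lemmas at the end. *)
definition lie_index :: nat where
  "lie_index = Min ((\<lambda>\<xi>. dim (stabilizer \<xi>)) ` dual_space)"

definition max_abelian_dim :: nat where
  "max_abelian_dim = Max (dim ` {A. abelian_subalgebra A})"

(* Rational-valued, so that neither the division by 2 nor c - 1 below truncates. *)
definition magic_number :: rat where
  "magic_number = (of_nat (dim UNIV) + of_nat lie_index) / 2"

definition rentschler_property :: bool where
  "rentschler_property \<longleftrightarrow> of_nat max_abelian_dim \<ge> magic_number - 1"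

end

locale fin_dim_lie_algebra = lie_algebra scale bracket
  for scale :: "'k::field \<Rightarrow> 'v::ab_group_add \<Rightarrow> 'v" and bracket :: "'v \<Rightarrow> 'v \<Rightarrow> 'v" +
  assumes finite_spanning: "\<exists>B. finite B \<and> span B = UNIV"
begin

lemma dim_le_dim_UNIV: "dim A \<le> dim UNIV"
proof -
  obtain B where "finite B" "span B = UNIV"
    using finite_spanning by blast
  obtain C where C: "C \<subseteq> B" "independent C" "B \<subseteq> span C"
    using maximal_independent_subset by blast
  have "span C = UNIV"
    using span_minimal[OF C(3) subspace_span] \<open>span B = UNIV\<close> by (simp add: top.extremum_unique)
  moreover have "finite C"
    using C(1) \<open>finite B\<close> by (rule finite_subset)
  ultimately interpret finite_dimensional_vector_space scale C
    using C(2) by unfold_locales auto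
  show ?thesis by (rule dim_subset) simp
qed

lemma lie_index_wf:
  "finite ((\<lambda>\<xi>. dim (stabilizer \<xi>)) ` dual_space)" "(\<lambda>\<xi>. dim (stabilizer \<xi>)) ` dual_space \<noteq> {}"
proof -
  show "finite ((\<lambda>\<xi>. dim (stabilizer \<xi>)) ` dual_space)"
    by (rule finite_subset[of _ "{..dim UNIV}"]) (auto intro: dim_le_dim_UNIV)
  have "(\<lambda>_. 0) \<in> dual_space"
    unfolding dual_space_def mem_Collect_eq
    by unfold_locales (simp_all add: algebra_simps)
  then show "(\<lambda>\<xi>. dim (stabilizer \<xi>)) ` dual_space \<noteq> {}" by blast
qed

lemma max_abelian_dim_wf:
  "finite (dim ` {A. abelian_subalgebra A})" "dim ` {A. abelian_subalgebra A} \<noteq> {}"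
proof -
  show "finite (dim ` {A. abelian_subalgebra A})"
    by (rule finite_subset[of _ "{..dim UNIV}"]) (auto intro: dim_le_dim_UNIV)
  have "abelian_subalgebra {0}"
    by (auto simp: abelian_subalgebra_def lie_subalgebra_def bracket_self)
  then show "dim ` {A. abelian_subalgebra A} \<noteq> {}" by blast
qed

end

end

theory Submission
  imports Defs
begin

text \<open>
  A functional \<open>\<xi>\<close> on \<open>L\<close> gives the alternating form \<open>B\<^sub>\<xi>(x, y) = \<xi>([x, y])\<close>, whose radical is
  \<open>L(\<xi>)\<close>. The hypothesis \<open>i(L) \<ge> n - 2\<close> says that all these forms have rank at most 2. If all of
  them vanish, \<open>L\<close> is abelian and \<open>L\<close> itself is large enough. Otherwise choose \<open>\<xi>\<close> with
  \<open>B\<^sub>\<xi> \<noteq> 0\<close>. Then \<open>L(\<xi>)\<close> has dimension exactly \<open>n - 2\<close>, so \<open>c(L) - 1 \<le> n - 2\<close>, and it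
  suffices that \<open>L(\<xi>)\<close> be abelian.

  This follows by perturbing \<open>\<xi>\<close>. Let \<open>\<xi>([x, y]) = 1\<close>, let \<open>u, v \<in> L(\<xi>)\<close>, and let \<open>\<eta>\<close> be any
  functional. The form of \<open>t\<xi> + \<eta>\<close> has rank at most 2, so its Pfaffian on \<open>x, y, u, v\<close> is zero.
  Because \<open>u\<close> and \<open>v\<close> lie in the radical of \<open>B\<^sub>\<xi>\<close>, this Pfaffian is
  \<open>(t + \<eta>[x, y]) \<eta>[u, v]\<close> plus a term without \<open>t\<close>. It vanishes for all \<open>t\<close>, hence
  \<open>\<eta>[u, v] = 0\<close>. As \<open>\<eta>\<close> was arbitrary, \<open>[u, v] = 0\<close>.

  The argument is carried by \<open>pfaffian_rank_two\<close> and \<open>stabilizer_commutes\<close>.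
\<close>

context lie_algebra
begin

lemma bracket_add_left: "bracket (x + y) z = bracket x z + bracket y z"
  and bracket_scale_left: "bracket (scale c x) z = scale c (bracket x z)"
proof -
  interpret l: Vector_Spaces.linear scale scale "\<lambda>x. bracket x z"
    by (rule bracket_linear_left)
  show "bracket (x + y) z = bracket x z + bracket y z" by (rule l.add)
  show "bracket (scale c x) z = scale c (bracket x z)" by (rule l.scale)
qed

lemma bracket_add_right: "bracket z (x + y) = bracket z x + bracket z y"
  and bracket_scale_right: "bracket z (scale c x) = scale c (bracket z x)"
proof -
  interpret l: Vector_Spaces.linear scale scale "\<lambda>x. bracket z x"
    by (rule bracket_linear_right)
  show "bracket z (x + y) = bracket z x + bracket z y" by (rule l.add)
  show "bracket z (scale c x) = scale c (bracket z x)" by (rule l.scale)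
qed

lemma bracket_zero_left: "bracket 0 z = 0"
  using bracket_scale_left[of 0 0 z] by simp

lemma bracket_anticomm: "bracket y x = - bracket x y"
proof -
  have "bracket x y + bracket y x = bracket (x + y) (x + y)"
    unfolding bracket_add_left bracket_add_right by (simp add: bracket_self)
  then have "bracket x y + bracket y x = 0"
    by (simp only: bracket_self)
  then show ?thesis by (simp add: add_eq_0_iff)
qed

lemma dual_space_add: "\<xi> \<in> dual_space \<Longrightarrow> \<xi> (x + y) = \<xi> x + \<xi> y"
  and dual_space_scale: "\<xi> \<in> dual_space \<Longrightarrow> \<xi> (scale c x) = c * \<xi> x"
  by (auto simp: dual_space_def linear_iff_module_hom module_hom.add module_hom.scale)

lemma dual_space_zero: "\<xi> \<in> dual_space \<Longrightarrow> \<xi> 0 = 0"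
  using dual_space_scale[of \<xi> 0 0] by simp

lemma dual_space_neg: "\<xi> \<in> dual_space \<Longrightarrow> \<xi> (- x) = - \<xi> x"
  using dual_space_scale[of \<xi> "-1" x] by simp

lemma dual_space_pencil:
  assumes "\<xi> \<in> dual_space" "\<eta> \<in> dual_space"
  shows "(\<lambda>v. t * \<xi> v + \<eta> v) \<in> dual_space"
  unfolding dual_space_def mem_Collect_eq
  by unfold_locales
    (simp_all add: algebra_simps dual_space_add dual_space_scale assms)

lemma dual_space_separates:
  assumes "v \<noteq> 0"
  obtains \<eta> where "\<eta> \<in> dual_space" "\<eta> v \<noteq> 0"
proof -
  interpret vector_space_pair scale "(*) :: 'k \<Rightarrow> 'k \<Rightarrow> 'k"
    by unfold_locales (simp_all add: algebra_simps)
  have "independent {v}"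
    using assms by (simp add: independent_insert)
  then obtain \<eta> where "Vector_Spaces.linear scale (*) \<eta>" "\<forall>x\<in>{v}. \<eta> x = 1"
    using linear_independent_extend[of "{v}" "\<lambda>_. 1"] by blast
  then show ?thesis
    using that[of \<eta>] by (simp add: dual_space_def)
qed

lemma stabilizerD:
  assumes "\<xi> \<in> dual_space" "u \<in> stabilizer \<xi>"
  shows "\<xi> (bracket u z) = 0" "\<xi> (bracket z u) = 0"
  using assms by (auto simp: stabilizer_def bracket_anticomm[of z u] dual_space_neg)

lemma subspace_stabilizer:
  assumes "\<xi> \<in> dual_space"
  shows "subspace (stabilizer \<xi>)"
  by (rule subspaceI)
    (simp_all add: stabilizer_def bracket_zero_left bracket_add_left bracket_scale_left
      dual_space_zero[OF assms] dual_space_add[OF assms] dual_space_scale[OF assms])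

text \<open>
  If \<open>\<xi>([x, y]) \<noteq> 0\<close>, the form of \<open>\<xi>\<close> is nondegenerate on the plane of \<open>x\<close> and \<open>y\<close>, so that
  plane meets the radical only in 0.
\<close>

lemma independent_over_stabilizer:
  assumes \<xi>: "\<xi> \<in> dual_space" and xy: "\<xi> (bracket x y) \<noteq> 0"
    and B: "independent B" "span B = stabilizer \<xi>"
  shows "independent (insert x (insert y B))" "x \<notin> insert y B" "y \<notin> B"
proof -
  have y: "y \<notin> span B"
    using xy stabilizerD(2)[OF \<xi>] B(2) by blast
  have x: "x \<notin> span (insert y B)"
  proof
    assume "x \<in> span (insert y B)"
    then obtain k where "x - scale k y \<in> stabilizer \<xi>"
      by (auto simp: span_insert B(2))
    then have "\<xi> (bracket (x - scale k y) y) = 0"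
      by (rule stabilizerD(1)[OF \<xi>])
    moreover have "bracket (x - scale k y) y = bracket x y"
      using bracket_add_left[of "x - scale k y" "scale k y" y]
      by (simp add: bracket_scale_left bracket_self)
    ultimately show False using xy by simp
  qed
  show "independent (insert x (insert y B))"
    using x y B(1) by (simp add: independent_insertI)
  show "x \<notin> insert y B" "y \<notin> B"
    using x y span_base by blast+
qed

end

context fin_dim_lie_algebra
begin

lemma finite_basis:
  obtains C where "finite_dimensional_vector_space scale C"
proof -
  obtain S where S: "finite S" "span S = UNIV"
    using finite_spanning by blast
  obtain C where C: "C \<subseteq> S" "independent C" "S \<subseteq> span C"
    using maximal_independent_subset by blast
  have "span C = UNIV"
    using span_minimal[OF C(3) subspace_span] S(2) by (simp add: top.extremum_unique)
  moreover have "finite C"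
    using C(1) S(1) by (rule finite_subset)
  ultimately have "finite_dimensional_vector_space scale C"
    using C(2) by unfold_locales auto
  then show ?thesis by (rule that)
qed

lemma stabilizer_codim_ge_two:
  assumes \<xi>: "\<xi> \<in> dual_space" and xy: "\<xi> (bracket x y) \<noteq> 0"
  shows "dim (stabilizer \<xi>) + 2 \<le> dim UNIV"
    and "dim UNIV \<le> dim (stabilizer \<xi>) + 2 \<Longrightarrow> \<exists>a b. z - scale a x - scale b y \<in> stabilizer \<xi>"
proof -
  obtain C where "finite_dimensional_vector_space scale C"
    by (rule finite_basis)
  then interpret finite_dimensional_vector_space scale C .
  obtain B where B: "B \<subseteq> stabilizer \<xi>" "independent B" "stabilizer \<xi> \<subseteq> span B"
    "card B = dim (stabilizer \<xi>)"
    by (rule basis_exists)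
  have span_B: "span B = stabilizer \<xi>"
    using B(1,3) span_minimal[OF _ subspace_stabilizer[OF \<xi>]] by blast
  let ?D = "insert x (insert y B)"
  note D = independent_over_stabilizer[OF \<xi> xy B(2) span_B]
  have card_D: "card ?D = dim (stabilizer \<xi>) + 2"
    using D(2,3) finiteI_independent[OF B(2)] B(4) by simp
  show "dim (stabilizer \<xi>) + 2 \<le> dim UNIV"
    using independent_card_le_dim[OF subset_UNIV D(1)] card_D by simp
  assume "dim UNIV \<le> dim (stabilizer \<xi>) + 2"
  then have "UNIV \<subseteq> span ?D"
    using card_ge_dim_independent[OF subset_UNIV D(1)] card_D by simp
  then have "z \<in> span ?D" by blast
  then show "\<exists>a b. z - scale a x - scale b y \<in> stabilizer \<xi>"
    by (auto simp: span_insert span_B)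
qed

text \<open>
  This is the vanishing of the Pfaffian of the \<open>4 \<times> 4\<close> Gram matrix of \<open>x, y, u, v\<close> for a form of
  rank 2. Both sides are linear in \<open>v\<close> and zero when \<open>v\<close> lies in the radical, so \<open>v\<close> may be
  replaced by its component in the plane of \<open>x\<close> and \<open>y\<close>.
\<close>

lemma pfaffian_rank_two:
  assumes \<xi>: "\<xi> \<in> dual_space" and xy: "\<xi> (bracket x y) \<noteq> 0"
    and codim: "dim UNIV \<le> dim (stabilizer \<xi>) + 2"
  shows "\<xi> (bracket x y) * \<xi> (bracket u v)
    = \<xi> (bracket x u) * \<xi> (bracket y v) - \<xi> (bracket x v) * \<xi> (bracket y u)"
proof -
  obtain a b where "v - scale a x - scale b y \<in> stabilizer \<xi>"
    using stabilizer_codim_ge_two(2)[OF \<xi> xy codim] by blast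
  then obtain s where s: "s \<in> stabilizer \<xi>" "v = s + (scale a x + scale b y)"
    by (metis add.commute diff_add_cancel diff_diff_eq)
  have v: "\<xi> (bracket w v) = a * \<xi> (bracket w x) + b * \<xi> (bracket w y)" for w
    by (simp add: s(2) bracket_add_right bracket_scale_right dual_space_add[OF \<xi>]
        dual_space_scale[OF \<xi>] stabilizerD(2)[OF \<xi> s(1)])
  have anti: "\<xi> (bracket y x) = - \<xi> (bracket x y)" "\<xi> (bracket u x) = - \<xi> (bracket x u)"
    "\<xi> (bracket u y) = - \<xi> (bracket y u)"
    by (simp_all add: bracket_anticomm[of y x] bracket_anticomm[of u x] bracket_anticomm[of u y]
        dual_space_neg[OF \<xi>])
  show ?thesis
    by (simp add: v anti bracket_self dual_space_zero[OF \<xi>] algebra_simps)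
qed

end

text \<open>
  Perturbing \<open>\<xi>\<close> by an arbitrary \<open>\<eta>\<close> turns the Pfaffian identity into
  \<open>(t \<xi>[x, y] + \<eta>[x, y]) \<eta>[u, v] = \<eta>[x, u] \<eta>[y, v] - \<eta>[x, v] \<eta>[y, u]\<close>, in which only the left
  side depends on \<open>t\<close>. Comparing two values of \<open>t\<close> gives \<open>\<eta>[u, v] = 0\<close>. Both must make the
  first factor nonzero for the identity to apply; the values 1 and 2 of that factor will do, unless
  the characteristic is 2.
\<close>

lemma (in fin_dim_lie_algebra) stabilizer_commutes:
  assumes char: "(2 :: 'k) \<noteq> 0"
    and codim: "\<And>\<zeta>. \<zeta> \<in> dual_space \<Longrightarrow> dim UNIV \<le> dim (stabilizer \<zeta>) + 2"
    and \<xi>: "\<xi> \<in> dual_space" and xy: "\<xi> (bracket x y) \<noteq> 0"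
    and u: "u \<in> stabilizer \<xi>" and v: "v \<in> stabilizer \<xi>"
  shows "bracket u v = 0"
proof (rule ccontr)
  assume "bracket u v \<noteq> 0"
  then obtain \<eta> where \<eta>: "\<eta> \<in> dual_space" "\<eta> (bracket u v) \<noteq> 0"
    by (rule dual_space_separates)
  let ?R = "\<eta> (bracket x u) * \<eta> (bracket y v) - \<eta> (bracket x v) * \<eta> (bracket y u)"
  have *: "r * \<eta> (bracket u v) = ?R" if r: "r \<noteq> 0" for r
  proof -
    \<comment> \<open>This \<open>t\<close> makes \<open>t\<xi> + \<eta>\<close> take the value \<open>r\<close> at \<open>[x, y]\<close>.\<close>
    define t where "t = (r - \<eta> (bracket x y)) / \<xi> (bracket x y)"
    let ?\<zeta> = "\<lambda>w. t * \<xi> w + \<eta> w"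
    have \<zeta>: "?\<zeta> \<in> dual_space"
      by (rule dual_space_pencil[OF \<xi> \<eta>(1)])
    have r_eq: "?\<zeta> (bracket x y) = r"
      using xy by (simp add: t_def)
    show ?thesis
      using pfaffian_rank_two[OF \<zeta> _ codim[OF \<zeta>], of x y u v] r
      unfolding r_eq by (simp add: stabilizerD[OF \<xi> u] stabilizerD[OF \<xi> v])
  qed
  have "1 * \<eta> (bracket u v) = 2 * \<eta> (bracket u v)"
    using *[OF one_neq_zero] *[OF char] by (rule trans[OF _ sym])
  then have "\<eta> (bracket u v) = \<eta> (bracket u v) + \<eta> (bracket u v)"
    by (simp only: mult_1 mult_2)
  then show False using \<eta>(2) by (simp only: add_cancel_right_right)
qed

theorem lemma3p2:
  fixes scale :: "'k::{alg_closed_field, field_char_0} \<Rightarrow> 'v::ab_group_add \<Rightarrow> 'v"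
    and bracket :: "'v \<Rightarrow> 'v \<Rightarrow> 'v"
    and n :: nat
  assumes "fin_dim_lie_algebra scale bracket"
    and "vector_space.dim scale (UNIV :: 'v set) = n"
    and "int (lie_algebra.lie_index scale bracket) \<ge> int n - 2"
  shows "lie_algebra.rentschler_property scale bracket"
proof -
  interpret fin_dim_lie_algebra scale bracket by (rule assms(1))
  have index_le: "lie_index \<le> dim (stabilizer \<xi>)" if "\<xi> \<in> dual_space" for \<xi>
    unfolding lie_index_def using lie_index_wf(1) that by (intro Min_le) auto
  have codim: "dim UNIV \<le> dim (stabilizer \<xi>) + 2" if "\<xi> \<in> dual_space" for \<xi>
    using index_le[OF that] assms(2,3) by linarith
  have abelian_le: "dim A \<le> max_abelian_dim" if "abelian_subalgebra A" for A
    unfolding max_abelian_dim_def using max_abelian_dim_wf(1) that by (intro Max_ge) auto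
  have "n + lie_index \<le> 2 * max_abelian_dim + 2"
  proof (cases "\<exists>x y. bracket x y \<noteq> 0")
    case True
    then obtain x y where "bracket x y \<noteq> 0" by blast
    then obtain \<xi> where \<xi>: "\<xi> \<in> dual_space" and xy: "\<xi> (bracket x y) \<noteq> 0"
      by (rule dual_space_separates)
    have comm: "bracket u v = 0" if "u \<in> stabilizer \<xi>" "v \<in> stabilizer \<xi>" for u v
      by (rule stabilizer_commutes[OF _ codim \<xi> xy that]) simp_all
    have "abelian_subalgebra (stabilizer \<xi>)"
      unfolding abelian_subalgebra_def lie_subalgebra_def
      using subspace_stabilizer[OF \<xi>] comm subspace_0[OF subspace_stabilizer[OF \<xi>]] by auto
    then have "dim (stabilizer \<xi>) \<le> max_abelian_dim"
      by (rule abelian_le)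
    then show ?thesis
      using codim[OF \<xi>] stabilizer_codim_ge_two(1)[OF \<xi> xy] index_le[OF \<xi>] assms(2) by linarith
  next
    case False
    then have "abelian_subalgebra UNIV"
      by (auto simp: abelian_subalgebra_def lie_subalgebra_def)
    then have "n \<le> max_abelian_dim"
      using abelian_le assms(2) by blast
    moreover have "(\<lambda>_. 0) \<in> dual_space"
      unfolding dual_space_def mem_Collect_eq
      by unfold_locales (simp_all add: algebra_simps)
    then have "lie_index \<le> n"
      using index_le dim_le_dim_UNIV assms(2) le_trans by blast
    ultimately show ?thesis by linarith
  qed
  then have "(of_nat (n + lie_index) :: rat) \<le> of_nat (2 * max_abelian_dim + 2)"
    by (rule of_nat_mono)
  then show ?thesis
    unfolding rentschler_property_def magic_number_def assms(2) by (simp add: field_simps)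
qed

end
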